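(* Let $X$ and $Y$ be F-$\mathbb{BC}$ modules and let $T:X\to Y$ be a closed $\mathbb{BC}$-linear map. Then $T$ is continuous.
   Context: Bicomplex and hyperbolic numbers. $\mathbb{BC}=\{z_1+z_2 j : z_1,z_2\in\mathbb{C}(i)\}$ with $i^2=j^2=-1$, $ij=ji=k$ (so $k^2=1$); it is a commutative ring. $\mathbb{D}=\{\beta_1+k\beta_2:\beta_1,\beta_2\in\mathbb{R}\}\subset\mathbb{BC}$ is the ring of hyperbolic numbers. With $e_1=\frac{1+k}{2}$, $e_2=\frac{1-k}{2}$ one has $e_1^2=e_1$, $e_2^2=e_2$, $e_1+e_2=1$, $e_1e_2=0$, and each $Z\in\mathbb{BC}$ is uniquely $Z=e_1z_1+e_2z_2$ with $z_1,z_2\in\mathbb{C}(i)$; $Z\in\mathbb{D}$ iff $z_1,z_2$ are real. Put $|Z|_k=e_1|z_1|+e_2|z_2|$. Let $\mathbb{D}^+=\{e_1\alpha_1+e_2\alpha_2:\alpha_1,\alpha_2\ge 0\}$. The partial order on $\mathbb{D}$ is $\alpha\le\beta$ iff $\beta-\alpha\in\mathbb{D}^+$. Convergence in $\mathbb{D}$ is componentwise with respect to $e_1,e_2$. Norms. A hyperbolic norm on a $\mathbb{BC}$-module $X$ is a map $\|\cdot\|_{\mathbb{D}}:X\to\mathbb{D}^+$ with $\|x\|_{\mathbb{D}}=0$ iff $x=0$; $\|\mu x\|_{\mathbb{D}}=|\mu|_k\|x\|_{\mathbb{D}}$ for $\mu\in\mathbb{BC}$; and $\|x+y\|_{\mathbb{D}}\le\|x\|_{\mathbb{D}}+\|y\|_{\mathbb{D}}$.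 $x_n\to x$ means $\|x_n-x\|_{\mathbb{D}}\to 0$ in $\mathbb{D}$. An F-$\mathbb{BC}$ module is a $\mathbb{BC}$-module with a hyperbolic norm for which every Cauchy sequence converges. Maps. $T:X\to Y$ is $\mathbb{BC}$-linear if $T(x+y)=T(x)+T(y)$ and $T(\mu x)=\mu T(x)$ for $x,y\in X$, $\mu\in\mathbb{BC}$. A $\mathbb{BC}$-linear map $T$ is closed if its graph is closed in $X\times Y$, i.e. whenever $x_n\to x$ in $X$ and $Tx_n\to y$ in $Y$, then $Tx=y$. Continuity means $x_n\to x$ implies $Tx_n\to Tx$. *)

theory Defs
  imports Complex_Main
begin

text \<open>\<open>Bicomplex z w\<close> stands for \<open>z + w j\<close> with \<open>z, w\<close> in \<open>C(i)\<close>.\<close>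

datatype bicomplex = Bicomplex (bc_fst: complex) (bc_snd: complex)

instantiation bicomplex :: comm_ring_1
begin

definition "0 = Bicomplex 0 0"
definition "1 = Bicomplex 1 0"
definition "- Z = Bicomplex (- bc_fst Z) (- bc_snd Z)"
definition "Z + W = Bicomplex (bc_fst Z + bc_fst W) (bc_snd Z + bc_snd W)"
definition "Z - W = Bicomplex (bc_fst Z - bc_fst W) (bc_snd Z - bc_snd W)"
definition "Z * W = Bicomplex (bc_fst Z * bc_fst W - bc_snd Z * bc_snd W)
                              (bc_fst Z * bc_snd W + bc_snd Z * bc_fst W)"

lemmas bicomplex_ring_defs =
  zero_bicomplex_def one_bicomplex_def uminus_bicomplex_def plus_bicomplex_def
  minus_bicomplex_def times_bicomplex_def

instance
  by standard (auto simp: bicomplex_ring_defs algebra_simps)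

end

definition bc_of_complex :: "complex \<Rightarrow> bicomplex" where
  "bc_of_complex z = Bicomplex z 0"

definition bc_of_real :: "real \<Rightarrow> bicomplex" where
  "bc_of_real r = bc_of_complex (complex_of_real r)"

definition bc_i :: bicomplex where "bc_i = bc_of_complex \<i>"
definition bc_j :: bicomplex where "bc_j = Bicomplex 0 1"
definition bc_k :: bicomplex where "bc_k = bc_i * bc_j"

definition bc_e1 :: bicomplex where "bc_e1 = bc_of_real (1/2) * (1 + bc_k)"
definition bc_e2 :: bicomplex where "bc_e2 = bc_of_real (1/2) * (1 - bc_k)"

lemmas bc_unit_defs =
  bc_of_complex_def bc_of_real_def bc_i_def bc_j_def bc_k_def bc_e1_def bc_e2_def

lemma bicomplex_eq: "Z = bc_of_complex (bc_fst Z) + bc_of_complex (bc_snd Z) * bc_j"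
  by (cases Z) (simp add: bc_unit_defs bicomplex_ring_defs)

lemma bc_units:
  "bc_i * bc_i = -1" "bc_j * bc_j = -1" "bc_j * bc_i = bc_k" "bc_k * bc_k = 1"
  by (auto simp: bc_unit_defs bicomplex_ring_defs)

lemma bc_idempotents:
  "bc_e1 * bc_e1 = bc_e1" "bc_e2 * bc_e2 = bc_e2"
  "bc_e1 + bc_e2 = 1" "bc_e1 * bc_e2 = 0"
  by (auto simp: bc_unit_defs bicomplex_ring_defs field_simps)

text \<open>The coordinates of \<open>Z = e1 z1 + e2 z2\<close> with respect to the idempotents;
  the explicit formulas come from solving \<open>z + w j = e1 z1 + e2 z2\<close>.\<close>

definition idem1 :: "bicomplex \<Rightarrow> complex" where
  "idem1 Z = bc_fst Z - \<i> * bc_snd Z"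

definition idem2 :: "bicomplex \<Rightarrow> complex" where
  "idem2 Z = bc_fst Z + \<i> * bc_snd Z"

lemma idempotent_decomposition:
  "Z = bc_e1 * bc_of_complex z1 + bc_e2 * bc_of_complex z2 \<longleftrightarrow> z1 = idem1 Z \<and> z2 = idem2 Z"
  by (cases Z) (auto simp: idem1_def idem2_def bc_unit_defs bicomplex_ring_defs
      field_simps complex_eq_iff)

definition hyperbolic :: "bicomplex set" where
  "hyperbolic = {bc_of_real b1 + bc_k * bc_of_real b2 | b1 b2. True}"

definition hyperbolic_nonneg :: "bicomplex set" where
  "hyperbolic_nonneg = {bc_e1 * bc_of_real a1 + bc_e2 * bc_of_real a2 | a1 a2. 0 \<le> a1 \<and> 0 \<le> a2}"

definition hyp_le :: "bicomplex \<Rightarrow> bicomplex \<Rightarrow> bool" (infix "\<le>\<^sub>D" 50) where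
  "\<alpha> \<le>\<^sub>D \<beta> \<longleftrightarrow> \<alpha> \<in> hyperbolic \<and> \<beta> \<in> hyperbolic \<and> \<beta> - \<alpha> \<in> hyperbolic_nonneg"

definition mod_k :: "bicomplex \<Rightarrow> bicomplex" where
  "mod_k Z = bc_e1 * bc_of_real (cmod (idem1 Z)) + bc_e2 * bc_of_real (cmod (idem2 Z))"

lemma hyperbolic_iff: "Z \<in> hyperbolic \<longleftrightarrow> idem1 Z \<in> \<real> \<and> idem2 Z \<in> \<real>"
proof
  assume "Z \<in> hyperbolic"
  then show "idem1 Z \<in> \<real> \<and> idem2 Z \<in> \<real>"
    by (auto simp: hyperbolic_def idem1_def idem2_def bc_unit_defs bicomplex_ring_defs)
next
  assume "idem1 Z \<in> \<real> \<and> idem2 Z \<in> \<real>"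
  then have "Im (idem1 Z) = 0" "Im (idem2 Z) = 0"
    by (auto simp: complex_is_Real_iff)
  then have "Z = bc_of_real (Re (bc_fst Z)) + bc_k * bc_of_real (Im (bc_snd Z))"
    by (cases Z) (auto simp: idem1_def idem2_def bc_unit_defs bicomplex_ring_defs complex_eq_iff)
  then show "Z \<in> hyperbolic"
    unfolding hyperbolic_def by blast
qed

text \<open>Componentwise convergence with respect to \<open>e1, e2\<close>, along an arbitrary filter so that it
  covers both sequences and the double sequences in the Cauchy condition.  It is only applied to
  hyperbolic-valued functions, whose components are real.\<close>

definition hyp_tendsto :: "('i \<Rightarrow> bicomplex) \<Rightarrow> bicomplex \<Rightarrow> 'i filter \<Rightarrow> bool" where
  "hyp_tendsto f L F \<longleftrightarrow>
     ((\<lambda>n. idem1 (f n)) \<longlongrightarrow> idem1 L) F \<and> ((\<lambda>n. idem2 (f n)) \<longlongrightarrow> idem2 L) F"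

locale hyperbolic_normed_module = module scale
  for scale :: "bicomplex \<Rightarrow> 'a::ab_group_add \<Rightarrow> 'a" +
  fixes hnorm :: "'a \<Rightarrow> bicomplex"
  assumes hnorm_nonneg: "hnorm x \<in> hyperbolic_nonneg"
    and hnorm_eq_0_iff: "hnorm x = 0 \<longleftrightarrow> x = 0"
    and hnorm_scale: "hnorm (scale \<mu> x) = mod_k \<mu> * hnorm x"
    and hnorm_triangle: "hnorm (x + y) \<le>\<^sub>D hnorm x + hnorm y"

definition hconverges :: "('a::ab_group_add \<Rightarrow> bicomplex) \<Rightarrow> (nat \<Rightarrow> 'a) \<Rightarrow> 'a \<Rightarrow> bool" where
  "hconverges N X x \<longleftrightarrow> hyp_tendsto (\<lambda>n. N (X n - x)) 0 sequentially"

definition hCauchy :: "('a::ab_group_add \<Rightarrow> bicomplex) \<Rightarrow> (nat \<Rightarrow> 'a) \<Rightarrow> bool" where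
  "hCauchy N X \<longleftrightarrow> hyp_tendsto (\<lambda>(m, n). N (X m - X n)) 0 (sequentially \<times>\<^sub>F sequentially)"

locale F_BC_module = hyperbolic_normed_module +
  assumes complete: "hCauchy hnorm X \<Longrightarrow> \<exists>x. hconverges hnorm X x"

definition hclosed_graph ::
  "('a::ab_group_add \<Rightarrow> bicomplex) \<Rightarrow> ('b::ab_group_add \<Rightarrow> bicomplex) \<Rightarrow> ('a \<Rightarrow> 'b) \<Rightarrow> bool" where
  "hclosed_graph NX NY T \<longleftrightarrow>
     (\<forall>X x y. hconverges NX X x \<and> hconverges NY (\<lambda>n. T (X n)) y \<longrightarrow> T x = y)"

definition hcontinuous ::
  "('a::ab_group_add \<Rightarrow> bicomplex) \<Rightarrow> ('b::ab_group_add \<Rightarrow> bicomplex) \<Rightarrow> ('a \<Rightarrow> 'b) \<Rightarrow> bool" where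
  "hcontinuous NX NY T \<longleftrightarrow>
     (\<forall>X x. hconverges NX X x \<longrightarrow> hconverges NY (\<lambda>n. T (X n)) (T x))"

end

theory Submission
  imports Defs "HOL-Analysis.Urysohn"
begin

text \<open>With \<open>\<parallel>x\<parallel>\<^sub>D = e1 a + e2 b\<close>, the number \<open>a + b\<close> is an ordinary real norm inducing the same
  convergence and the same Cauchy sequences, so that both modules are Banach spaces over the reals
  and the classical closed graph theorem applies.  For the latter, the closures of the sets
  \<open>{x. \<parallel>T x\<parallel> \<le> n}\<close> cover the domain, so by Baire every \<open>x\<close> in some ball around the origin is a
  limit of vectors whose images are bounded by a constant.  Correcting the error in ever smaller
  balls writes \<open>x\<close> as a series whose image converges geometrically; as the graph is closed, the
  sum of the image series is \<open>T x\<close>, which bounds \<open>T\<close> on the ball.\<close>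

section \<open>The closed graph theorem for real normed spaces given by an explicit norm\<close>

text \<open>The spaces of the theorem carry only an additive group structure as types, so the norm is a
  locale parameter and the type class \<open>banach\<close> is not available.\<close>

locale normed_space = vector_space scale
  for scale :: "real \<Rightarrow> 'a::ab_group_add \<Rightarrow> 'a" +
  fixes N :: "'a \<Rightarrow> real"
  assumes N_nonneg: "0 \<le> N x"
    and N_eq_0_iff: "N x = 0 \<longleftrightarrow> x = 0"
    and N_scale: "N (scale r x) = \<bar>r\<bar> * N x"
    and N_triangle: "N (x + y) \<le> N x + N y"
begin

lemma N_minus: "N (- x) = N x"
  using N_scale[of "-1" x] by simp

lemma N_diff_triangle: "N (x - y) \<le> N x + N y"
  using N_triangle[of x "- y"] by (simp add: N_minus)

lemma N_diff_commute: "N (x - y) = N (y - x)"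
  using N_minus[of "x - y"] by simp

text \<open>Makes the Baire category theorem for explicitly given metrics applicable.\<close>

sublocale Metric_space UNIV "\<lambda>x y. N (x - y)"
proof
  show "N (x - z) \<le> N (x - y) + N (y - z)" for x y z
    using N_triangle[of "x - y" "y - z"] by simp
qed (auto simp: N_nonneg N_diff_commute N_eq_0_iff)

lemma limitin_iff_tendsto:
  "limitin mtopology X x sequentially \<longleftrightarrow> (\<lambda>n. N (X n - x)) \<longlonglongrightarrow> 0"
  by (simp add: limitin_metric tendsto_iff N_nonneg)

lemma N_le_of_tendsto:
  assumes lim: "(\<lambda>n. N (X n - x)) \<longlonglongrightarrow> 0" and bd: "\<And>n. N (X n) \<le> B"
  shows "N x \<le> B"
proof (rule LIMSEQ_le_const)
  show "(\<lambda>n. B + N (X n - x)) \<longlonglongrightarrow> B"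
    using tendsto_add[OF tendsto_const lim] by simp
  have "N x \<le> B + N (X n - x)" for n
    using N_diff_triangle[of "X n" "X n - x"] bd[of n] by simp
  then show "\<exists>m. \<forall>n\<ge>m. N x \<le> B + N (X n - x)"
    by blast
qed

section \<open>Sequences with geometrically decreasing steps\<close>

text \<open>The right-hand side is the exact sum of \<open>K / 2 ^ k\<close> over
  \<open>m \<le> k < n\<close>; keeping the subtracted term lets the induction close.\<close>

lemma N_diff_geometric:
  fixes S :: "nat \<Rightarrow> 'a"
  assumes step: "\<And>k. N (S (Suc k) - S k) \<le> K / 2 ^ k" and "m \<le> n"
  shows "N (S n - S m) \<le> 2 * K / 2 ^ m - 2 * K / 2 ^ n"
  using \<open>m \<le> n\<close>
proof (induction n rule: dec_induct)
  case base
  then show ?case using N_eq_0_iff[of 0] by simp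
next
  case (step n)
  have "N (S (Suc n) - S m) \<le> N (S (Suc n) - S n) + N (S n - S m)"
    by (rule triangle) auto
  also have "\<dots> \<le> K / 2 ^ n + (2 * K / 2 ^ m - 2 * K / 2 ^ n)"
    using step.IH assms(1)[of n] by linarith
  finally show ?case by (simp add: field_simps)
qed

lemma MCauchy_geometric:
  fixes S :: "nat \<Rightarrow> 'a"
  assumes step: "\<And>k. N (S (Suc k) - S k) \<le> K / 2 ^ k"
  shows "MCauchy S"
  unfolding MCauchy_def
proof (intro conjI allI impI)
  fix \<epsilon> :: real assume "\<epsilon> > 0"
  have K: "0 \<le> K" using order_trans[OF N_nonneg step[of 0]] by simp
  have "(\<lambda>m. 2 * K / 2 ^ m) \<longlonglongrightarrow> 0"
    using tendsto_mult[OF tendsto_const LIMSEQ_realpow_zero[of "1/2"]]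
    by (fastforce simp: power_one_over field_simps)
  then have "\<forall>\<^sub>F m in sequentially. 2 * K / 2 ^ m < \<epsilon>"
    using \<open>\<epsilon> > 0\<close> by (rule order_tendstoD(2))
  then obtain M where M: "\<And>m. m \<ge> M \<Longrightarrow> 2 * K / 2 ^ m < \<epsilon>"
    unfolding eventually_sequentially by blast
  have *: "N (S n - S m) < \<epsilon>" if "M \<le> m" "m \<le> n" for m n
    using N_diff_geometric[of S K, OF step \<open>m \<le> n\<close>] M[of m] that K
    by (smt (verit) divide_nonneg_nonneg zero_le_power)
  have "N (S n - S n') < \<epsilon>" if "M \<le> n" "M \<le> n'" for n n'
    using *[of n n'] *[of n' n] that N_diff_commute by (metis nle_le)
  then show "\<exists>M. \<forall>n n'. M \<le> n \<longrightarrow> M \<le> n' \<longrightarrow> N (S n - S n') < \<epsilon>"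
    by blast
qed auto

end

locale complete_normed_space = normed_space +
  assumes mcomplete: "mcomplete"

section \<open>Closed graph theorem\<close>

locale closed_graph_map =
  X: complete_normed_space sX NX + Y: complete_normed_space sY NY + module_hom sX sY T
  for sX :: "real \<Rightarrow> 'a::ab_group_add \<Rightarrow> 'a" and NX
    and sY :: "real \<Rightarrow> 'b::ab_group_add \<Rightarrow> 'b" and NY
    and T :: "'a \<Rightarrow> 'b" +
  assumes closed_graph:
    "(\<lambda>n. NX (S n - x)) \<longlonglongrightarrow> 0 \<Longrightarrow> (\<lambda>n. NY (T (S n) - y)) \<longlonglongrightarrow> 0 \<Longrightarrow> T x = y"
begin

text \<open>Baire yields a ball around some \<open>a\<close> inside the closure of one
  \<open>A n\<close>. Subtracting approximants of \<open>a\<close> from approximants of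
  \<open>a + x\<close> moves the ball to the origin and doubles the bound to
  \<open>K = 2 * n\<close>.\<close>

lemma almost_bounded_on_ball:
  obtains r K where "0 < r" and
    "\<And>x \<epsilon>. NX x < r \<Longrightarrow> 0 < \<epsilon> \<Longrightarrow> \<exists>u. NY (T u) \<le> K \<and> NX (x - u) < \<epsilon>"
proof -
  define A where "A n = {x. NY (T x) \<le> real n}" for n
  have "\<exists>n. X.mtopology interior_of (X.mtopology closure_of A n) \<noteq> {}"
  proof (rule ccontr)
    assume "\<not> ?thesis"
    \<comment> \<open>If every closure had empty interior, so would the union, which however is the
      whole nonempty space.\<close>
    then have "X.mtopology interior_of (\<Union>n. X.mtopology closure_of A n) = {}"
      by (intro X.metric_Baire_category_alt X.mcomplete) auto
    moreover have "x \<in> X.mtopology closure_of A (nat \<lceil>NY (T x)\<rceil>)" for x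
      by (rule subsetD[OF closure_of_subset]) (auto simp: A_def real_nat_ceiling_ge)
    then have "(\<Union>n. X.mtopology closure_of A n) = topspace X.mtopology"
      by auto
    ultimately show False by (simp only: interior_of_topspace) simp
  qed
  then obtain n a r where r: "0 < r"
    and ball: "X.mball a r \<subseteq> X.mtopology closure_of A n"
    unfolding ex_in_conv[symmetric] X.in_interior_of_mball by blast
  have near: "\<exists>u \<in> A n. NX (z - u) < \<epsilon>" if "NX (a - z) < r" "0 < \<epsilon>" for z \<epsilon>
  proof -
    have "z \<in> X.mtopology closure_of A n" using that ball by auto
    then show ?thesis using \<open>0 < \<epsilon>\<close> by (auto simp: X.metric_closure_of)
  qed
  show thesis
  proof
    fix x \<epsilon> assume x: "NX x < r" and e: "0 < (\<epsilon>::real)"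
    obtain u where u: "u \<in> A n" "NX (a + x - u) < \<epsilon> / 2"
      using near[of "a + x" "\<epsilon> / 2"] x e X.N_minus by auto
    obtain v where v: "v \<in> A n" "NX (a - v) < \<epsilon> / 2"
      using near[of a "\<epsilon> / 2"] r e X.N_eq_0_iff[of 0] by auto
    have "NY (T (u - v)) \<le> NY (T u) + NY (T v)"
      by (simp add: diff Y.N_diff_triangle)
    then have "NY (T (u - v)) \<le> 2 * real n"
      using u v by (simp add: A_def)
    moreover have "x - (u - v) = (a + x - u) - (a - v)" by simp
    then have "NX (x - (u - v)) \<le> NX (a + x - u) + NX (a - v)"
      by (metis X.N_diff_triangle)
    then have "NX (x - (u - v)) < \<epsilon>"
      using u v by linarith
    ultimately show "\<exists>u. NY (T u) \<le> 2 * real n \<and> NX (x - u) < \<epsilon>" by blast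
  qed (rule r)
qed

text \<open>Approximations with bounded image are summed up: the errors halve at each step and so do
  the image increments, whence the total bound \<open>2 * K\<close> on the same ball.\<close>

lemma bounded_on_ball:
  obtains r B where "0 < r" "\<And>x. NX x < r \<Longrightarrow> NY (T x) \<le> B"
proof -
  obtain r K where r: "0 < r" and approx:
    "\<And>x \<epsilon>. NX x < r \<Longrightarrow> 0 < \<epsilon> \<Longrightarrow> \<exists>u. NY (T u) \<le> K \<and> NX (x - u) < \<epsilon>"
    using almost_bounded_on_ball by blast
  \<comment> \<open>By homogeneity: enlarge \<open>x\<close> by \<open>2 ^ k\<close>, approximate
    within \<open>r / 2\<close>, and shrink back.\<close>
  have approx_scaled: "\<exists>u. NY (T u) \<le> K / 2 ^ k \<and> NX (x - u) < r / 2 ^ Suc k"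
    if "NX x < r / 2 ^ k" for x k
  proof -
    have "NX (sX (2 ^ k) x) < r"
      using that by (simp add: X.N_scale field_simps)
    then obtain u where u: "NY (T u) \<le> K" "NX (sX (2 ^ k) x - u) < r / 2"
      using approx[of "sX (2 ^ k) x" "r / 2"] r by auto
    define w where "w = sX (1 / 2 ^ k) u"
    have "x - w = sX (1 / 2 ^ k) (sX (2 ^ k) x - u)"
      by (simp add: w_def X.scale_right_diff_distrib)
    then have "NX (x - w) = NX (sX (2 ^ k) x - u) / 2 ^ k"
      by (simp only: X.N_scale) simp
    then have "NX (x - w) < r / 2 ^ Suc k"
      using u by (simp add: field_simps)
    moreover have "NY (T w) \<le> K / 2 ^ k"
      using u by (simp add: w_def scale Y.N_scale field_simps)
    ultimately show ?thesis by blast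
  qed
  show thesis
  proof
    fix x assume x: "NX x < r"
    \<comment> \<open>\<open>S k\<close> is the sum of the first \<open>k\<close> corrections.
      Starting at 0 turns the bound on \<open>T (S n) - T (S 0)\<close> into one on
      \<open>T (S n)\<close>.\<close>
    have "\<exists>S. \<forall>k. (NX (x - S k) < r / 2 ^ k \<and> (k = 0 \<longrightarrow> S k = 0)) \<and>
      NY (T (S (Suc k)) - T (S k)) \<le> K / 2 ^ k"
    proof (rule dependent_nat_choice)
      show "\<exists>s. NX (x - s) < r / 2 ^ 0 \<and> (0 = (0::nat) \<longrightarrow> s = 0)"
        using x by auto
      fix s k assume "NX (x - s) < r / 2 ^ k \<and> (k = 0 \<longrightarrow> s = 0)"
      then obtain u where "NY (T u) \<le> K / 2 ^ k" "NX ((x - s) - u) < r / 2 ^ Suc k"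
        using approx_scaled by blast
      then show "\<exists>t. (NX (x - t) < r / 2 ^ Suc k \<and> (Suc k = 0 \<longrightarrow> t = 0)) \<and>
          NY (T t - T s) \<le> K / 2 ^ k"
        by (intro exI[of _ "s + u"]) (simp add: add diff_diff_eq)
    qed
    then obtain S where S: "\<And>k. NX (x - S k) < r / 2 ^ k" "S 0 = 0"
        "\<And>k. NY (T (S (Suc k)) - T (S k)) \<le> K / 2 ^ k"
      by metis
    have "Y.MCauchy (\<lambda>k. T (S k))"
      by (rule Y.MCauchy_geometric[OF S(3)])
    then obtain y where y: "(\<lambda>k. NY (T (S k) - y)) \<longlonglongrightarrow> 0"
      using Y.mcomplete by (auto simp: Y.mcomplete_def Y.limitin_iff_tendsto)
    have geom: "(\<lambda>k. r / 2 ^ k) \<longlonglongrightarrow> 0"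
      using tendsto_mult[OF tendsto_const LIMSEQ_realpow_zero[of "1/2"]]
      by (fastforce simp: power_one_over field_simps)
    have "(\<lambda>k. NX (S k - x)) \<longlonglongrightarrow> 0"
      by (rule tendsto_sandwich[OF _ _ tendsto_const geom])
        (auto simp: X.N_nonneg X.N_diff_commute[of _ x] less_imp_le S(1))
    then have "T x = y"
      using y closed_graph by blast
    moreover have "NY y \<le> 2 * K"
    proof (rule Y.N_le_of_tendsto[OF y])
      \<comment> \<open>The sign of \<open>K\<close> allows dropping the subtracted term of the
        geometric sum.\<close>
      have "0 \<le> K" using order_trans[OF Y.N_nonneg S(3)[of 0]] by simp
      then show "NY (T (S n)) \<le> 2 * K" for n
        using Y.N_diff_geometric[of "\<lambda>k. T (S k)" K 0 n, OF S(3)] S(2)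
        by (smt (verit) diff_zero div_by_1 divide_nonneg_nonneg le0 power_0 zero zero_le_power)
    qed
    ultimately show "NY (T x) \<le> 2 * K" by simp
  qed (rule r)
qed

theorem continuous:
  assumes "(\<lambda>n. NX (S n - x)) \<longlonglongrightarrow> 0"
  shows "(\<lambda>n. NY (T (S n) - T x)) \<longlonglongrightarrow> 0"
proof -
  obtain r B where r: "0 < r" and B: "\<And>x. NX x < r \<Longrightarrow> NY (T x) \<le> B"
    using bounded_on_ball by blast
  have bound: "NY (T z) \<le> 2 * B / r * NX z" for z
  proof (cases "z = 0")
    case True
    then show ?thesis using X.N_eq_0_iff[of 0] Y.N_eq_0_iff[of 0] by simp
  next
    case False
    then have pos: "0 < NX z"
      using X.N_eq_0_iff[of z] X.N_nonneg[of z] by simp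
    \<comment> \<open>The rescaled vector has norm \<open>r / 2\<close>, strictly inside the ball,
      which gives the Lipschitz constant \<open>2 * B / r\<close>.\<close>
    have "NX (sX (r / (2 * NX z)) z) < r"
      using pos r by (simp add: X.N_scale)
    from B[OF this] show ?thesis
      using pos r by (simp add: scale Y.N_scale field_simps)
  qed
  show ?thesis
    by (rule tendsto_sandwich[OF _ _ tendsto_const tendsto_mult_right_zero[OF assms]])
      (auto simp: Y.N_nonneg simp flip: diff intro: always_eventually bound)
qed

end

section \<open>From hyperbolic to real norms\<close>

definition idem_norm :: "bicomplex \<Rightarrow> real" where
  "idem_norm Z = cmod (idem1 Z) + cmod (idem2 Z)"

lemma idem_add: "idem1 (Z + W) = idem1 Z + idem1 W" "idem2 (Z + W) = idem2 Z + idem2 W"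
  by (simp_all add: idem1_def idem2_def plus_bicomplex_def algebra_simps)

lemma idem_mult: "idem1 (Z * W) = idem1 Z * idem1 W" "idem2 (Z * W) = idem2 Z * idem2 W"
  by (simp_all add: idem1_def idem2_def times_bicomplex_def algebra_simps complex_eq_iff)

lemma idem_of_real: "idem1 (bc_of_real r) = of_real r" "idem2 (bc_of_real r) = of_real r"
  by (simp_all add: idem1_def idem2_def bc_unit_defs)

lemma idem_0: "idem1 0 = 0" "idem2 0 = 0"
  by (simp_all add: idem1_def idem2_def zero_bicomplex_def)

lemma idem_mod_k: "idem1 (mod_k Z) = of_real (cmod (idem1 Z))"
    "idem2 (mod_k Z) = of_real (cmod (idem2 Z))"
  using idempotent_decomposition[of "mod_k Z" "of_real (cmod (idem1 Z))" "of_real (cmod (idem2 Z))"]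
  by (simp_all add: mod_k_def bc_of_real_def)

lemma hyperbolic_nonneg_idem:
  assumes "Z \<in> hyperbolic_nonneg"
  obtains a b where "0 \<le> a" "0 \<le> b" "idem1 Z = complex_of_real a" "idem2 Z = complex_of_real b"
proof -
  obtain a b where ab: "0 \<le> a" "0 \<le> b" and Z: "Z = bc_e1 * bc_of_real a + bc_e2 * bc_of_real b"
    using assms by (auto simp: hyperbolic_nonneg_def)
  have "of_real a = idem1 Z" "of_real b = idem2 Z"
    using idempotent_decomposition[of Z "of_real a" "of_real b"] Z by (simp_all add: bc_of_real_def)
  then show thesis using that ab by metis
qed

lemma idem_norm_eq_0_iff: "idem_norm Z = 0 \<longleftrightarrow> Z = 0"
proof
  assume "idem_norm Z = 0"
  then have "idem1 Z = 0" "idem2 Z = 0"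
    by (simp_all add: idem_norm_def add_nonneg_eq_0_iff)
  then show "Z = 0"
    using idempotent_decomposition[of Z 0 0] idempotent_decomposition[of 0 0 0] by (simp add: idem_0)
qed (simp add: idem_norm_def idem_0)

lemma idem_norm_triangle: "idem_norm (Z + W) \<le> idem_norm Z + idem_norm W"
  unfolding idem_norm_def idem_add
  using norm_triangle_ineq[of "idem1 Z" "idem1 W"] norm_triangle_ineq[of "idem2 Z" "idem2 W"]
  by linarith

text \<open>The idempotent coordinates of \<open>Z\<close> and \<open>W - Z\<close> are nonnegative
  reals, so their moduli add up to those of \<open>W\<close>.\<close>

lemma idem_norm_mono:
  assumes "Z \<in> hyperbolic_nonneg" "Z \<le>\<^sub>D W"
  shows "idem_norm Z \<le> idem_norm W"
proof -
  obtain a b where ab: "0 \<le> a" "0 \<le> b" "idem1 Z = complex_of_real a" "idem2 Z = complex_of_real b"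
    using assms(1) by (rule hyperbolic_nonneg_idem)
  obtain c d where cd: "0 \<le> c" "0 \<le> d"
    "idem1 (W - Z) = complex_of_real c" "idem2 (W - Z) = complex_of_real d"
    using assms(2) unfolding hyp_le_def by (blast elim: hyperbolic_nonneg_idem)
  have "idem1 W = of_real (a + c)" "idem2 W = of_real (b + d)"
    using idem_add[of Z "W - Z"] ab cd by simp_all
  then have "cmod (idem1 W) = a + c" "cmod (idem2 W) = b + d"
    using ab cd by (simp_all only: norm_of_real abs_of_nonneg add_nonneg_nonneg)
  then show ?thesis
    using ab cd by (simp add: idem_norm_def)
qed

text \<open>Each coordinate is dominated by the sum of the two moduli.\<close>

lemma hyp_tendsto_0_iff: "hyp_tendsto f 0 F \<longleftrightarrow> ((\<lambda>n. idem_norm (f n)) \<longlongrightarrow> 0) F"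
proof
  assume "hyp_tendsto f 0 F"
  then show "((\<lambda>n. idem_norm (f n)) \<longlongrightarrow> 0) F"
    unfolding hyp_tendsto_def idem_norm_def idem_0
    by (intro tendsto_add_zero tendsto_norm_zero) auto
next
  assume *: "((\<lambda>n. idem_norm (f n)) \<longlongrightarrow> 0) F"
  show "hyp_tendsto f 0 F"
    unfolding hyp_tendsto_def idem_0
    by (intro conjI; rule Lim_null_comparison[OF _ *]) (simp_all add: idem_norm_def)
qed

section \<open>Hyperbolic modules as real normed spaces\<close>

context hyperbolic_normed_module
begin

text \<open>Homogeneity holds because both idempotent coordinates of a real scalar \<open>a\<close>
  equal \<open>a\<close>, so \<open>\<bar>a\<bar>\<close> factors out of the sum.\<close>

sublocale real: normed_space "\<lambda>r. scale (bc_of_real r)" "\<lambda>x. idem_norm (hnorm x)"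
proof
  fix a b :: real and x y
  show "scale (bc_of_real a) (x + y) = scale (bc_of_real a) x + scale (bc_of_real a) y"
    by (rule scale_right_distrib)
  show "scale (bc_of_real (a + b)) x = scale (bc_of_real a) x + scale (bc_of_real b) x"
    by (simp add: scale_left_distrib[symmetric] bc_unit_defs plus_bicomplex_def)
  show "scale (bc_of_real a) (scale (bc_of_real b) x) = scale (bc_of_real (a * b)) x"
    by (simp add: bc_unit_defs times_bicomplex_def)
  have "bc_of_real 1 = 1"
    by (simp add: bc_unit_defs one_bicomplex_def)
  then show "scale (bc_of_real 1) x = x"
    by simp
  show "0 \<le> idem_norm (hnorm x)"
    by (simp add: idem_norm_def)
  show "idem_norm (hnorm x) = 0 \<longleftrightarrow> x = 0"
    by (simp add: idem_norm_eq_0_iff hnorm_eq_0_iff)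
  show "idem_norm (hnorm (scale (bc_of_real a) x)) = \<bar>a\<bar> * idem_norm (hnorm x)"
    by (simp add: hnorm_scale idem_norm_def idem_mult idem_mod_k idem_of_real norm_mult algebra_simps)
  show "idem_norm (hnorm (x + y)) \<le> idem_norm (hnorm x) + idem_norm (hnorm y)"
    using idem_norm_mono[OF hnorm_nonneg hnorm_triangle] idem_norm_triangle by (rule order_trans)
qed

lemma hconverges_iff: "hconverges hnorm X x \<longleftrightarrow> (\<lambda>n. idem_norm (hnorm (X n - x))) \<longlonglongrightarrow> 0"
  by (simp add: hconverges_def hyp_tendsto_0_iff)

lemma hCauchy_of_MCauchy:
  assumes "real.MCauchy X"
  shows "hCauchy hnorm X"
  unfolding hCauchy_def hyp_tendsto_0_iff tendsto_iff eventually_prod_sequentially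
  using assms by (fastforce simp: real.MCauchy_def real.N_nonneg)

end

context F_BC_module
begin

sublocale real: complete_normed_space "\<lambda>r. scale (bc_of_real r)" "\<lambda>x. idem_norm (hnorm x)"
proof
  show "real.mcomplete"
    unfolding real.mcomplete_def real.limitin_iff_tendsto
    using complete hCauchy_of_MCauchy by (auto simp: hconverges_iff)
qed

end

theorem theorem4p2:
  fixes scaleX :: "bicomplex \<Rightarrow> 'a::ab_group_add \<Rightarrow> 'a"
    and scaleY :: "bicomplex \<Rightarrow> 'b::ab_group_add \<Rightarrow> 'b"
    and normX :: "'a \<Rightarrow> bicomplex"
    and normY :: "'b \<Rightarrow> bicomplex"
    and T :: "'a \<Rightarrow> 'b"
  assumes "F_BC_module scaleX normX"
    and "F_BC_module scaleY normY"
    and "module_hom scaleX scaleY T"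
    and "hclosed_graph normX normY T"
  shows "hcontinuous normX normY T"
proof -
  interpret X: F_BC_module scaleX normX by fact
  interpret Y: F_BC_module scaleY normY by fact
  interpret T: module_hom scaleX scaleY T by fact
  \<comment> \<open>Restricting scalars to the reals keeps \<open>T\<close> linear, and
    \<open>hconverges_iff\<close> carries the closed graph over to the real norms.\<close>
  interpret closed_graph_map "\<lambda>r. scaleX (bc_of_real r)" "\<lambda>x. idem_norm (normX x)"
    "\<lambda>r. scaleY (bc_of_real r)" "\<lambda>y. idem_norm (normY y)" T
  proof
    show "T x = y" if "(\<lambda>n. idem_norm (normX (S n - x))) \<longlonglongrightarrow> 0"
      "(\<lambda>n. idem_norm (normY (T (S n) - y))) \<longlonglongrightarrow> 0" for S x y
      using that assms(4) unfolding hclosed_graph_def X.hconverges_iff Y.hconverges_iff by blast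
  qed (auto simp: T.add T.scale)
  show ?thesis
    unfolding hcontinuous_def X.hconverges_iff Y.hconverges_iff using continuous by blast
qed

end
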